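(* Let $\mu$ be a ULC probability measure on $\mathbb N^d$, and let $\mathbf P\in\mathbb R_{\ge0}^{d\times m}$ satisfy $\sum_{j=1}^mP_{ij}\le1$ for all $i\in[d]$. Suppose that $\mathbf X\sim\mu$, and let $\mathbf X'$ be the output of the particlewise stochastic projection channel associated with $\mathbf P$. Then $\nu=\mathrm{Law}(\mathbf X')$ is ULC on $\mathbb N^m$.
   Context: $\mathbb N=\{0,1,2,\dots\}$, $[d]=\{1,\dots,d\}$, $\mathbf e_i$ is the $i$-th standard basis vector, $\mathbf n!=\prod_in_i!$. Particlewise stochastic projection channel associated with $\mathbf P$: conditional on $\mathbf X=\mathbf n$, regard $\mathbf n$ as a configuration with $n_i$ particles of type $i$, $i\in[d]$. Independently, each particle of input type $i$ is assigned output type $j\in[m]$ with probability $P_{ij}$ and is discarded with probability $1-\sum_{j=1}^mP_{ij}$. The output $\mathbf X'\in\mathbb N^m$ is the vector of resulting particle counts of the $m$ output types. ULC: a set $S\subseteq\mathbb N^d$ is downward closed if $\mathbf n\in S$ and $\mathbf 0\le\mathbf m\le\mathbf n$ (coordinatewise) imply $\mathbf m\in S$. A probability measure $\mu$ on $\mathbb N^d$ with downward closed support is ULC (ultra-log-concave) if, with $a(\mathbf n)=\mathbf n!\,\mu(\mathbf n)$ and $\mathcal I_{\mathbf n}=\{i\in[d]:\mathbf n+\mathbf e_i\in\mathrm{supp}(\mu)\}$, the matrix $\big(1-\frac{a(\mathbf n)a(\mathbf n+\mathbf e_i+\mathbf e_j)}{a(\mathbf n+\mathbf e_i)a(\mathbf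 n+\mathbf e_j)}\big)_{i,j\in\mathcal I_{\mathbf n}}$ is positive semidefinite for every $\mathbf n\in\mathrm{supp}(\mu)$. *)

theory Defs
  imports "HOL-Analysis.Analysis" "HOL-Probability.Probability"
begin

text \<open>
  Vectors in \<open>\<nat>\<^sup>d\<close> are elements of \<open>nat ^ 'd\<close>, whose library order is the coordinatewise one;
  the standard basis vector \<open>e\<^sub>i\<close> is \<open>axis i 1\<close>. Since \<open>\<nat>\<^sup>d\<close> is countable and discrete,
  probability measures on it are probability mass functions, with support \<open>set_pmf\<close>.
\<close>

definition downward_closed :: "(nat ^ 'd) set \<Rightarrow> bool" where
  "downward_closed S \<longleftrightarrow> (\<forall>n\<in>S. \<forall>m. m \<le> n \<longrightarrow> m \<in> S)"

definition vec_fact :: "nat ^ 'd \<Rightarrow> real" where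
  "vec_fact n = (\<Prod>i\<in>UNIV. fact (n $ i))"

definition psd_on :: "'i set \<Rightarrow> ('i \<Rightarrow> 'i \<Rightarrow> real) \<Rightarrow> bool" where
  "psd_on I A \<longleftrightarrow> (\<forall>i\<in>I. \<forall>j\<in>I. A i j = A j i) \<and>
     (\<forall>v :: 'i \<Rightarrow> real. 0 \<le> (\<Sum>i\<in>I. \<Sum>j\<in>I. v i * A i j * v j))"

definition ulc_weight :: "(nat ^ 'd) pmf \<Rightarrow> nat ^ 'd \<Rightarrow> real" where
  "ulc_weight \<mu> n = vec_fact n * pmf \<mu> n"

definition up_neighbours :: "(nat ^ 'd) pmf \<Rightarrow> nat ^ 'd \<Rightarrow> 'd set" where
  "up_neighbours \<mu> n = {i. n + axis i 1 \<in> set_pmf \<mu>}"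

definition ulc :: "(nat ^ 'd) pmf \<Rightarrow> bool" where
  "ulc \<mu> \<longleftrightarrow> downward_closed (set_pmf \<mu>) \<and>
     (\<forall>n\<in>set_pmf \<mu>. psd_on (up_neighbours \<mu> n)
        (\<lambda>i j. 1 - ulc_weight \<mu> n * ulc_weight \<mu> (n + axis i 1 + axis j 1)
                 / (ulc_weight \<mu> (n + axis i 1) * ulc_weight \<mu> (n + axis j 1))))"

text \<open>
  Output of a single particle of input type \<open>i\<close>: \<open>Some j\<close> is output type \<open>j\<close> and \<open>None\<close> is
  discarding. The value is meaningful only for a nonnegative \<open>i\<close>-th row of sum at most \<open>1\<close>;
  \<open>pmf_particle_output\<close> below gives the probabilities in that case.
\<close>

definition particle_output :: "real ^ 'm ^ 'd \<Rightarrow> 'd \<Rightarrow> 'm option pmf" where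
  "particle_output P i = embed_pmf
     (\<lambda>x. case x of None \<Rightarrow> 1 - (\<Sum>j\<in>UNIV. P $ i $ j) | Some j \<Rightarrow> P $ i $ j)"

lemma pmf_particle_output:
  fixes P :: "real ^ 'm ^ 'd"
  assumes "\<And>j. 0 \<le> P $ i $ j" and "(\<Sum>j\<in>UNIV. P $ i $ j) \<le> 1"
  shows "pmf (particle_output P i) x =
    (case x of None \<Rightarrow> 1 - (\<Sum>j\<in>UNIV. P $ i $ j) | Some j \<Rightarrow> P $ i $ j)"
proof -
  let ?f = "\<lambda>x. case x of None \<Rightarrow> 1 - (\<Sum>j\<in>UNIV. P $ i $ j) | Some j \<Rightarrow> P $ i $ j"
  have nn: "0 \<le> ?f y" for y using assms by (auto split: option.split)
  have "(\<Sum>y\<in>UNIV. ?f y) = 1"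
    by (simp add: UNIV_option_conv sum.reindex)
  then have "(\<integral>\<^sup>+ y. ennreal (?f y) \<partial>count_space UNIV) = 1"
    using nn by (subst nn_integral_count_space_finite) (simp_all add: sum_ennreal)
  with nn show ?thesis unfolding particle_output_def by (intro pmf_embed_pmf) auto
qed

text \<open>The particles of a configuration: \<open>(i, k)\<close> with \<open>k < n $ i\<close> is the \<open>k\<close>-th particle of type \<open>i\<close>.\<close>

definition particles :: "nat ^ 'd \<Rightarrow> ('d \<times> nat) set" where
  "particles n = (SIGMA i:UNIV. {..<n $ i})"

definition output_counts :: "('d \<times> nat) set \<Rightarrow> ('d \<times> nat \<Rightarrow> 'm option) \<Rightarrow> nat ^ 'm" where
  "output_counts S \<sigma> = (\<chi> j. card {p\<in>S. \<sigma> p = Some j})"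

text \<open>
  Conditional law of the output given the input configuration \<open>n\<close>.
\<close>

definition projection_channel :: "real ^ 'm ^ 'd \<Rightarrow> nat ^ 'd \<Rightarrow> (nat ^ 'm) pmf" where
  "projection_channel P n =
     map_pmf (output_counts (particles n))
       (Pi_pmf (particles n) None (\<lambda>(i, k). particle_output P i))"

definition channel_output_law :: "real ^ 'm ^ 'd \<Rightarrow> (nat ^ 'd) pmf \<Rightarrow> (nat ^ 'm) pmf" where
  "channel_output_law P \<mu> = bind_pmf \<mu> (projection_channel P)"

end

theory Submission
  imports Defs
begin

text \<open>
  Put \<open>a n = n! \<mu> n\<close>, the Taylor coefficients at \<open>0\<close> of the generating function \<open>F\<close> of \<open>\<mu>\<close>. Being ULC
  means that every derivative of \<open>F\<close> is log-concave at \<open>0\<close> to second order. The channel substitutes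
  \<open>x\<^sub>i = q\<^sub>i + \<Sum>\<^sub>j P\<^sub>i\<^sub>j y\<^sub>j\<close> in \<open>F\<close>, so that \<open>m! \<nu> m\<close> is \<open>D\<^sup>m exp D\<^sub>q F\<close> at \<open>0\<close>, with \<open>D\<^sub>j\<close> the derivative along
  column \<open>j\<close> of \<open>P\<close> and \<open>D\<^sub>q\<close> the one along \<open>q\<close>. It therefore suffices that every operator
  \<open>p\<^sub>0 + \<Sum>\<^sub>i p\<^sub>i \<partial>\<^sub>i\<close> with nonnegative coefficients preserves the class: this gives \<open>D\<^sub>j\<close> directly, and
  \<open>exp D\<^sub>q\<close> as the limit of \<open>(1 + D\<^sub>q / l)\<^sup>l\<close>. Summands are added one at a time; the two Lorentzian
  forms that are added are nonpositive on a common hyperplane, hence so is their sum.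
\<close>

subsection \<open>Directional derivatives of ULC sequences\<close>

definition unit_shift :: "'d option \<Rightarrow> nat ^ 'd" where
  "unit_shift i = (case i of None \<Rightarrow> 0 | Some i \<Rightarrow> axis i 1)"

lemma unit_shift_simps [simp]: "unit_shift None = 0" "unit_shift (Some i) = axis i 1"
  by (simp_all add: unit_shift_def)

text \<open>On Taylor coefficients a partial derivative is an index shift, so this is the operator
  \<open>p None\<close> plus the sum of \<open>p (Some i)\<close> times the \<open>i\<close>-th
  derivative. Indexing by \<open>option\<close> puts the identity term and the derivatives into one
  finite sum.\<close>

definition dshift :: "('d option \<Rightarrow> real) \<Rightarrow> (nat ^ 'd \<Rightarrow> real) \<Rightarrow> nat ^ 'd \<Rightarrow> real" where
  "dshift p a n = (\<Sum>i\<in>UNIV. p i * a (n + unit_shift i))"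

lemma sum_option_UNIV: "(\<Sum>i\<in>UNIV. f i) = f None + (\<Sum>i\<in>UNIV. f (Some i))"
  for f :: "'d::finite option \<Rightarrow> 'b::comm_monoid_add"
  by (simp add: UNIV_option_conv sum.reindex)

lemma dshift_option: "dshift p a n = p None * a n + (\<Sum>i\<in>UNIV. p (Some i) * a (n + axis i 1))"
  by (simp add: dshift_def sum_option_UNIV)

lemma dshift_commute: "dshift p (dshift q a) = dshift q (dshift p a)"
proof
  fix n
  have "dshift p (dshift q a) n =
      (\<Sum>i\<in>UNIV. \<Sum>j\<in>UNIV. p i * q j * a (n + unit_shift i + unit_shift j))"
    by (simp add: dshift_def sum_distrib_left mult.assoc)
  also have "\<dots> = (\<Sum>j\<in>UNIV. \<Sum>i\<in>UNIV. p i * q j * a (n + unit_shift i + unit_shift j))"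
    by (rule sum.swap)
  also have "\<dots> = dshift q (dshift p a) n"
    by (simp add: dshift_def sum_distrib_left mult_ac add_ac)
  finally show "dshift p (dshift q a) n = dshift q (dshift p a) n" .
qed

lemma dshift_add_dir: "dshift (\<lambda>i. p i + s * q i) a n = dshift p a n + s * dshift q a n"
  by (simp add: dshift_def algebra_simps sum.distrib sum_distrib_left)

lemma dshift_add: "dshift p (\<lambda>n. a n + s * b n) n = dshift p a n + s * dshift p b n"
  by (simp add: dshift_def algebra_simps sum.distrib sum_distrib_left)

text \<open>\<open>dshift v (dshift w a) n\<close> is a symmetric bilinear form in \<open>v\<close>
  and \<open>w\<close>; the sign arguments below expand its quadratic form along a line.\<close>

lemma dshift_add_dir2:
  "dshift (\<lambda>i. p i + s * q i) (dshift (\<lambda>i. p i + s * q i) a) n =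
    dshift p (dshift p a) n + 2 * s * dshift p (dshift q a) n + s\<^sup>2 * dshift q (dshift q a) n"
proof -
  have *: "dshift (\<lambda>i. p i + s * q i) a = (\<lambda>n. dshift p a n + s * dshift q a n)"
    by (rule ext) (rule dshift_add_dir)
  show ?thesis
    unfolding * dshift_add_dir dshift_add using dshift_commute[of p q a]
    by (simp add: algebra_simps power2_eq_square)
qed

lemma dshift_nonneg: "(\<And>i. 0 \<le> p i) \<Longrightarrow> (\<And>n. 0 \<le> a n) \<Longrightarrow> 0 \<le> dshift p a n"
  by (simp add: dshift_def sum_nonneg)

text \<open>With \<open>a n = n! \<mu> n\<close>, this is the ULC condition with all denominators cleared. The
  coefficient \<open>v None\<close> is harmless: replacing \<open>v\<close> by \<open>v + s e\<^sub>0\<close> changes both sides equally.\<close>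

definition ulc_seq :: "(nat ^ 'd \<Rightarrow> real) \<Rightarrow> bool" where
  "ulc_seq a \<longleftrightarrow> (\<forall>n. 0 \<le> a n) \<and> (\<forall>n i. a n = 0 \<longrightarrow> a (n + axis i 1) = 0) \<and>
     (\<forall>n v. a n * dshift v (dshift v a) n \<le> (dshift v a n)\<^sup>2)"

lemma ulc_seqD:
  assumes "ulc_seq a"
  shows "0 \<le> a n" "a n = 0 \<Longrightarrow> a (n + axis i 1) = 0"
    "a n * dshift v (dshift v a) n \<le> (dshift v a n)\<^sup>2"
  using assms by (auto simp: ulc_seq_def)

section \<open>Quadratic forms of ULC sequences\<close>

lemma ulc_seq_zero_dshift:
  assumes "ulc_seq a" "a n = 0"
  shows "dshift v a n = 0"
  using ulc_seqD(2)[OF assms] assms(2) by (simp add: dshift_option)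

lemma ulc_seq_zero_dshift2:
  assumes "ulc_seq a" "a n = 0"
  shows "dshift v (dshift w a) n = 0"
proof -
  have "dshift w a (n + axis i 1) = 0" for i
    by (rule ulc_seq_zero_dshift[OF assms(1) ulc_seqD(2)[OF assms]])
  then show ?thesis using ulc_seq_zero_dshift[OF assms] by (simp add: dshift_option)
qed

text \<open>Moving \<open>w\<close> along \<open>q\<close> into the kernel of
  \<open>v \<mapsto> dshift v a n\<close> makes the form nonpositive by the ULC inequality.
  Orthogonality removes the cross term, and the square of \<open>q\<close> is nonnegative, so the
  form at \<open>w\<close> is no larger than at the moved vector.\<close>

lemma ulc_seq_orthogonal_nonpos:
  assumes a: "ulc_seq a" and q: "\<And>i. 0 \<le> q i" and pos: "0 < dshift q a n"
    and orth: "dshift w (dshift q a) n = 0"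
  shows "dshift w (dshift w a) n \<le> 0"
proof -
  have "a n \<noteq> 0" using ulc_seq_zero_dshift[OF a] pos by force
  then have an: "0 < a n" using ulc_seqD(1)[OF a, of n] by linarith
  define s where "s = - (dshift w a n / dshift q a n)"
  let ?v = "\<lambda>i. w i + s * q i"
  have "dshift ?v a n = 0" unfolding dshift_add_dir using pos by (simp add: s_def)
  then have "a n * dshift ?v (dshift ?v a) n \<le> 0"
    using ulc_seqD(3)[OF a, of n ?v] by simp
  then have "dshift ?v (dshift ?v a) n \<le> 0" using an by (simp add: mult_le_0_iff)
  moreover have "0 \<le> s\<^sup>2 * dshift q (dshift q a) n"
    by (intro mult_nonneg_nonneg dshift_nonneg q ulc_seqD(1)[OF a]) simp
  ultimately show ?thesis unfolding dshift_add_dir2 using orth by simp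
qed

text \<open>A quadratic form that is nonpositive on a hyperplane not containing \<open>e\<^sub>0\<close> satisfies the reverse
  Cauchy--Schwarz inequality against \<open>e\<^sub>0\<close>. The hyperplane is the kernel of
  \<open>v \<mapsto> dshift v b n\<close>.\<close>

lemma reverse_cauchy_schwarz_of_hyperplane:
  assumes c: "0 \<le> c n" and b: "b n \<noteq> 0"
    and neg: "\<And>w. dshift w b n = 0 \<Longrightarrow> dshift w (dshift w c) n \<le> 0"
  shows "c n * dshift v (dshift v c) n \<le> (dshift v c n)\<^sup>2"
proof -
  let ?e = "\<lambda>i. if i = None then 1 else 0 :: real"
  have e: "dshift ?e f = f" for f :: "nat ^ 'a \<Rightarrow> real"
    by (rule ext) (simp add: dshift_option)
  define s where "s = - (dshift v b n / b n)"
  let ?w = "\<lambda>i. v i + s * ?e i"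
  have "dshift ?w b n = 0" using b unfolding dshift_add_dir e by (simp add: s_def)
  from neg[OF this] have "dshift v (dshift v c) n + 2 * s * dshift v c n + s\<^sup>2 * c n \<le> 0"
    unfolding dshift_add_dir2 e .
  from mult_left_mono[OF this c]
  have "c n * dshift v (dshift v c) n + 2 * (s * c n) * dshift v c n + (s * c n)\<^sup>2 \<le> 0"
    by (simp add: algebra_simps power2_eq_square)
  moreover have "0 \<le> (s * c n + dshift v c n)\<^sup>2" by simp
  ultimately show ?thesis by (simp add: power2_sum)
qed

lemma zero_of_affine_bounded:
  fixes c :: real
  assumes "\<And>t. t * c \<le> d"
  shows "c = 0"
proof (rule ccontr)
  assume "c \<noteq> 0"
  then show False using assms[of "(d + 1) / c"] by simp
qed

text \<open>The combination \<open>z\<close> of \<open>q\<close> and \<open>p\<close> lies in the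
  kernel of \<open>v \<mapsto> dshift v a n\<close>, and its square is nonnegative since the cross
  term vanishes. Dropping this square from the ULC inequality along \<open>v + t z\<close> leaves a
  bound affine in \<open>t\<close> and valid for all real \<open>t\<close>. Its slope is therefore
  zero: \<open>z\<close> is in the radical of the form.\<close>

lemma ulc_seq_parallel:
  assumes a: "ulc_seq a" and p: "\<And>i. 0 \<le> p i" and q: "\<And>i. 0 \<le> q i"
    and pos: "0 < dshift p a n" and zero: "dshift p (dshift q a) n = 0"
  shows "dshift v (dshift q a) n = dshift q a n / dshift p a n * dshift v (dshift p a) n"
proof -
  have "a n \<noteq> 0" using ulc_seq_zero_dshift[OF a] pos by force
  then have an: "0 < a n" using ulc_seqD(1)[OF a, of n] by linarith
  define s where "s = - (dshift q a n / dshift p a n)"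
  define z where "z = (\<lambda>i. q i + s * p i)"
  have z0: "dshift z a n = 0" unfolding z_def dshift_add_dir using pos by (simp add: s_def)
  have "0 \<le> dshift q (dshift q a) n" "0 \<le> dshift p (dshift p a) n"
    by (intro dshift_nonneg p q ulc_seqD(1)[OF a])+
  then have zz: "0 \<le> dshift z (dshift z a) n"
    unfolding z_def dshift_add_dir2 using zero by (simp add: dshift_commute[of q p])
  have "t * (2 * a n * dshift v (dshift z a) n)
      \<le> (dshift v a n)\<^sup>2 - a n * dshift v (dshift v a) n" for t
  proof -
    have "a n * (dshift v (dshift v a) n + 2 * t * dshift v (dshift z a) n +
        t\<^sup>2 * dshift z (dshift z a) n) \<le> (dshift v a n)\<^sup>2"
      using ulc_seqD(3)[OF a, of n "\<lambda>i. v i + t * z i"]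
      unfolding dshift_add_dir2 unfolding dshift_add_dir z0 by simp
    moreover have "0 \<le> a n * (t\<^sup>2 * dshift z (dshift z a) n)" using an zz by simp
    ultimately show ?thesis by (simp add: algebra_simps)
  qed
  from zero_of_affine_bounded[OF this] an have "dshift v (dshift z a) n = 0" by simp
  moreover have "dshift z a = (\<lambda>n. dshift q a n + s * dshift p a n)"
    unfolding z_def by (rule ext) (rule dshift_add_dir)
  ultimately have "dshift v (dshift q a) n + s * dshift v (dshift p a) n = 0"
    using dshift_add[of v "dshift q a" s "dshift p a" n] by simp
  then show ?thesis by (simp add: s_def)
qed

text \<open>The quadratic forms of \<open>dshift p a\<close> and \<open>dshift q a\<close> at \<open>n\<close> are both nonpositive on a common
  hyperplane: the polar of \<open>q\<close> for the first form is the polar of \<open>p\<close> for the second one. If this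
  polar contains \<open>e\<^sub>0\<close>, then the polars of \<open>e\<^sub>0\<close> for the two forms coincide.\<close>

lemma ulc_seq_dshift_add:
  assumes a: "ulc_seq a" and p: "\<And>i. 0 \<le> p i" and q: "\<And>i. 0 \<le> q i"
    and A: "ulc_seq (dshift p a)" and C: "ulc_seq (dshift q a)"
  shows "ulc_seq (dshift (\<lambda>i. p i + q i) a)"
proof -
  define c where "c = (\<lambda>n. dshift p a n + dshift q a n)"
  have sum: "dshift (\<lambda>i. p i + q i) a = c"
    using dshift_add_dir[of p 1 q a] by (simp add: c_def fun_eq_iff)
  have dc: "dshift v c n = dshift v (dshift p a) n + dshift v (dshift q a) n" for v n
    unfolding c_def using dshift_add[of v "dshift p a" 1 "dshift q a"] by simp
  have dc': "dshift v c = (\<lambda>n. dshift v (dshift p a) n + dshift v (dshift q a) n)" for v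
    by (rule ext) (rule dc)
  have ddc: "dshift v (dshift v c) n =
      dshift v (dshift v (dshift p a)) n + dshift v (dshift v (dshift q a)) n" for v n
    unfolding dc' using dshift_add[of v "dshift v (dshift p a)" 1 "dshift v (dshift q a)"] by simp
  note nn = ulc_seqD(1)[OF A] ulc_seqD(1)[OF C]
  have ineq: "c n * dshift v (dshift v c) n \<le> (dshift v c n)\<^sup>2" for n v
  proof (cases "dshift p a n = 0 \<or> dshift q a n = 0")
    \<comment> \<open>A summand vanishing at \<open>n\<close> has vanishing first and second shifts
      there, so only the inequality of the other summand remains.\<close>
    case True
    then show ?thesis
    proof
      assume 0: "dshift p a n = 0"
      show ?thesis unfolding ddc dc
        using ulc_seqD(3)[OF C, of n v] ulc_seq_zero_dshift[OF A 0] ulc_seq_zero_dshift2[OF A 0] 0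
        by (simp add: c_def)
    next
      assume 0: "dshift q a n = 0"
      show ?thesis unfolding ddc dc
        using ulc_seqD(3)[OF A, of n v] ulc_seq_zero_dshift[OF C 0] ulc_seq_zero_dshift2[OF C 0] 0
        by (simp add: c_def)
    qed
  next
    case False
    then have pos: "0 < dshift p a n" "0 < dshift q a n" using nn[of n] by auto
    have c0: "0 \<le> c n" using pos by (simp add: c_def)
    show ?thesis
    proof (cases "dshift p (dshift q a) n = 0")
      \<comment> \<open>The common polar now contains the \<open>None\<close> direction and cannot
        serve as the hyperplane. The kernel of \<open>w \<mapsto> dshift w (dshift p a) n\<close>
        replaces it; by parallelism it also kills \<open>dshift w (dshift q a) n\<close>.\<close>
      case True
      show ?thesis
      proof (rule reverse_cauchy_schwarz_of_hyperplane[where c = c, OF c0])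
        show "dshift p a n \<noteq> 0" using pos by simp
        fix w assume w: "dshift w (dshift p a) n = 0"
        have w': "dshift w (dshift q a) n = 0"
          using ulc_seq_parallel[OF a p q pos(1) True, of w] w by simp
        have "dshift w (dshift w (dshift p a)) n \<le> 0"
          using ulc_seqD(3)[OF A, of n w] w pos by (simp add: mult_le_0_iff)
        moreover have "dshift w (dshift w (dshift q a)) n \<le> 0"
          using ulc_seqD(3)[OF C, of n w] w' pos by (simp add: mult_le_0_iff)
        ultimately show "dshift w (dshift w c) n \<le> 0" unfolding ddc by simp
      qed
    next
      case False
      have pq: "0 < dshift p (dshift q a) n"
        using False dshift_nonneg[of p "dshift q a" n] p nn by force
      show ?thesis
      proof (rule reverse_cauchy_schwarz_of_hyperplane[where c = c, OF c0])
        show "dshift p (dshift q a) n \<noteq> 0" using False .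
        fix w assume w: "dshift w (dshift p (dshift q a)) n = 0"
        have "dshift w (dshift w (dshift q a)) n \<le> 0"
          by (rule ulc_seq_orthogonal_nonpos[OF C p pq w])
        \<comment> \<open>The roles of \<open>p\<close> and \<open>q\<close> are exchanged; as the
          operators commute, the orthogonality condition is the same.\<close>
        moreover have "dshift w (dshift w (dshift p a)) n \<le> 0"
          by (rule ulc_seq_orthogonal_nonpos[where q = q, OF A q])
            (use pq w in \<open>simp_all add: dshift_commute[of q p]\<close>)
        ultimately show "dshift w (dshift w c) n \<le> 0" unfolding ddc by simp
      qed
    qed
  qed
  have "c (n + axis i 1) = 0" if "c n = 0" for n i
  proof -
    have "dshift p a n = 0" "dshift q a n = 0" using that nn[of n] by (auto simp: c_def)
    then show ?thesis using ulc_seqD(2)[OF A] ulc_seqD(2)[OF C] by (simp add: c_def)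
  qed
  then show ?thesis unfolding sum ulc_seq_def using ineq nn by (auto simp: c_def)
qed

lemma ulc_seq_shift:
  assumes a: "ulc_seq a" and c: "0 \<le> c"
  shows "ulc_seq (\<lambda>n. c * a (n + k))"
proof -
  let ?b = "\<lambda>n. c * a (n + k)"
  have 1: "dshift v ?b n = c * dshift v a (n + k)" for v n
    by (simp add: dshift_def sum_distrib_left mult_ac add_ac)
  have 2: "dshift v (dshift v ?b) n = c * dshift v (dshift v a) (n + k)" for v n
    unfolding dshift_def[of v "dshift v ?b"] dshift_def[of v "dshift v a"] 1
    by (simp add: sum_distrib_left mult_ac add_ac)
  have 3: "?b n * dshift v (dshift v ?b) n \<le> (dshift v ?b n)\<^sup>2" for v n
    using mult_left_mono[OF ulc_seqD(3)[OF a, of "n + k" v], of "c\<^sup>2"]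
    unfolding 1 2 by (simp add: power2_eq_square algebra_simps)
  have "?b (n + axis i 1) = 0" if "?b n = 0" for n i
    using that ulc_seqD(2)[OF a, of "n + k" i] by (auto simp: add_ac)
  with 3 show ?thesis using ulc_seqD(1)[OF a] c unfolding ulc_seq_def by auto
qed

text \<open>A single coordinate gives a rescaled shift. The coordinates are adjoined one by one,
  starting from the zero sequence, which is a shift rescaled by \<open>0\<close>.\<close>

lemma ulc_seq_dshift:
  fixes p :: "'d::finite option \<Rightarrow> real"
  assumes a: "ulc_seq a" and p: "\<And>i. 0 \<le> p i"
  shows "ulc_seq (dshift p a)"
proof -
  have single: "ulc_seq (dshift (\<lambda>i. if i = x then p x else 0) a)" for x
  proof -
    have "dshift (\<lambda>i. if i = x then p x else 0) a = (\<lambda>n. p x * a (n + unit_shift x))"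
      by (simp add: dshift_def fun_eq_iff if_distrib[of "\<lambda>y. y * _"] cong: if_cong)
    then show ?thesis using ulc_seq_shift[OF a p] by simp
  qed
  have "ulc_seq (dshift (\<lambda>i. if i \<in> S then p i else 0) a)" if "finite S" for S
    using that
  proof (induction S rule: finite_induct)
    case empty
    show ?case using ulc_seq_shift[OF a, of 0 0] by (simp add: dshift_def [abs_def])
  next
    case (insert x S)
    have "(\<lambda>i. if i \<in> insert x S then p i else 0) =
        (\<lambda>i. (if i = x then p x else 0) + (if i \<in> S then p i else 0))"
      using insert.hyps by (auto simp: fun_eq_iff)
    then show ?case
      using ulc_seq_dshift_add[OF a _ _ single insert.IH] p by simp
  qed
  from this[of UNIV] show ?thesis by simp
qed

subsection \<open>Duality and the size-bias identity\<close>

text \<open>The transpose of \<open>dshift p\<close> for the counting measure. The guard excludes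
  the indices at which the subtraction of naturals would be truncated.\<close>

definition dshift_adj :: "('d option \<Rightarrow> real) \<Rightarrow> (nat ^ 'd \<Rightarrow> real) \<Rightarrow> nat ^ 'd \<Rightarrow> real" where
  "dshift_adj p w n =
    (\<Sum>i\<in>UNIV. p i * (if unit_shift i \<le> n then w (n - unit_shift i) else 0))"

text \<open>Values in \<open>ennreal\<close> allow duality for nonnegative functions without any
  summability assumption.\<close>

definition pairing :: "('a \<Rightarrow> real) \<Rightarrow> ('a \<Rightarrow> real) \<Rightarrow> ennreal" where
  "pairing w b = (\<integral>\<^sup>+ n. ennreal (w n * b n) \<partial>count_space UNIV)"

lemma vec_diff_add_cancel: "u \<le> n \<Longrightarrow> n - u + u = n" for n u :: "nat ^ 'd"
  by (simp add: vec_eq_iff less_eq_vec_def)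

lemma le_add_vec: "u \<le> n + u" for n u :: "nat ^ 'd"
  by (simp add: less_eq_vec_def)

lemma axis_le_iff: "axis i 1 \<le> n \<longleftrightarrow> 0 < n $ i" for n :: "nat ^ 'd"
  by (auto simp: less_eq_vec_def axis_def Suc_le_eq)

lemma nn_integral_vec_translate:
  fixes u :: "nat ^ 'd" and f :: "nat ^ 'd \<Rightarrow> ennreal"
  shows "(\<integral>\<^sup>+ n. f (n + u) \<partial>count_space UNIV) =
    (\<integral>\<^sup>+ n. (if u \<le> n then f n else 0) \<partial>count_space UNIV)"
proof -
  have "bij_betw (\<lambda>n. n + u) UNIV {n. u \<le> n}"
    by (rule bij_betw_byWitness[where f' = "\<lambda>n. n - u"])
      (auto simp: vec_diff_add_cancel le_add_vec)
  then have "(\<integral>\<^sup>+ n. f (n + u) \<partial>count_space UNIV) = (\<integral>\<^sup>+ n. f n \<partial>count_space {n. u \<le> n})"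
    by (rule nn_integral_bij_count_space)
  also have "\<dots> = (\<integral>\<^sup>+ n. f n * indicator {n. u \<le> n} n \<partial>count_space UNIV)"
    by (rule nn_integral_count_space_indicator) simp
  also have "\<dots> = (\<integral>\<^sup>+ n. (if u \<le> n then f n else 0) \<partial>count_space UNIV)"
    by (intro nn_integral_cong) simp
  finally show ?thesis .
qed

lemma pairing_dshift:
  assumes p: "\<And>i. 0 \<le> p i" and w: "\<And>n. 0 \<le> w n" and b: "\<And>n. 0 \<le> b n"
  shows "pairing w (dshift p b) = pairing (dshift_adj p w) b"
proof -
  have "pairing w (dshift p b) =
      (\<integral>\<^sup>+ n. (\<Sum>i\<in>UNIV. ennreal (w n * (p i * b (n + unit_shift i)))) \<partial>count_space UNIV)"
    using p w b by (simp add: pairing_def dshift_def sum_distrib_left sum_ennreal)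
  also have "\<dots> = (\<Sum>i\<in>UNIV. \<integral>\<^sup>+ n. ennreal (w n * (p i * b (n + unit_shift i))) \<partial>count_space UNIV)"
    by (rule nn_integral_sum) simp
  also have "\<dots> = (\<Sum>i\<in>UNIV. \<integral>\<^sup>+ n. ennreal
      (p i * (if unit_shift i \<le> n then w (n - unit_shift i) else 0) * b n) \<partial>count_space UNIV)"
  proof (intro sum.cong refl)
    fix i :: "'a option"
    let ?f = "\<lambda>n. ennreal (w (n - unit_shift i) * (p i * b n))"
    have "(\<integral>\<^sup>+ n. ennreal (w n * (p i * b (n + unit_shift i))) \<partial>count_space UNIV) =
        (\<integral>\<^sup>+ n. ?f (n + unit_shift i) \<partial>count_space UNIV)"
      by simp
    also have "\<dots> = (\<integral>\<^sup>+ n. (if unit_shift i \<le> n then ?f n else 0) \<partial>count_space UNIV)"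
      by (rule nn_integral_vec_translate)
    also have "\<dots> = (\<integral>\<^sup>+ n. ennreal
        (p i * (if unit_shift i \<le> n then w (n - unit_shift i) else 0) * b n) \<partial>count_space UNIV)"
      by (intro nn_integral_cong) (simp add: mult_ac)
    finally show "(\<integral>\<^sup>+ n. ennreal (w n * (p i * b (n + unit_shift i))) \<partial>count_space UNIV) = \<dots>" .
  qed
  also have "\<dots> = (\<integral>\<^sup>+ n. (\<Sum>i\<in>UNIV. ennreal
      (p i * (if unit_shift i \<le> n then w (n - unit_shift i) else 0) * b n)) \<partial>count_space UNIV)"
    by (rule nn_integral_sum[symmetric]) simp
  also have "\<dots> = pairing (dshift_adj p w) b"
    unfolding pairing_def dshift_adj_def sum_distrib_right
    by (intro nn_integral_cong sum_ennreal) (use p w b in simp)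
  finally show ?thesis .
qed

section \<open>The law of the output counts of a set of particles\<close>

definition counts_law :: "real ^ 'm ^ 'd \<Rightarrow> ('d \<times> nat) set \<Rightarrow> (nat ^ 'm) pmf" where
  "counts_law P S =
    map_pmf (output_counts S) (Pi_pmf S None (\<lambda>p. particle_output P (fst p)))"

definition output_unit :: "'m option \<Rightarrow> nat ^ 'm" where
  "output_unit y = (case y of None \<Rightarrow> 0 | Some j \<Rightarrow> axis j 1)"

lemma projection_channel_eq: "projection_channel P n = counts_law P (particles n)"
  by (simp add: projection_channel_def counts_law_def case_prod_unfold)

lemma finite_particles [simp]: "finite (particles n)"
  by (simp add: particles_def)

lemma output_counts_insert:
  assumes "finite T" "p \<notin> T"
  shows "output_counts (insert p T) \<sigma> = output_counts T \<sigma> + output_unit (\<sigma> p)"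
proof (rule vec_eq_iff[THEN iffD2], rule allI)
  fix j
  have "{q \<in> insert p T. \<sigma> q = Some j} =
      (if \<sigma> p = Some j then insert p {q \<in> T. \<sigma> q = Some j} else {q \<in> T. \<sigma> q = Some j})"
    by auto
  then show "output_counts (insert p T) \<sigma> $ j = (output_counts T \<sigma> + output_unit (\<sigma> p)) $ j"
    using assms by (auto simp: output_counts_def output_unit_def axis_def split: option.splits)
qed

text \<open>Independence of one particle from the rest: changing the assignment at \<open>p\<close>
  does not affect the counts over \<open>T\<close>.\<close>

lemma joint_law_insert:
  assumes "finite T" "p \<notin> T"
  shows "map_pmf (\<lambda>\<sigma>. (\<sigma> p, output_counts T \<sigma>))
      (Pi_pmf (insert p T) None (\<lambda>p. particle_output P (fst p))) =
    pair_pmf (particle_output P (fst p)) (counts_law P T)"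
proof -
  have oc: "output_counts T (f(p := y)) = output_counts T f" for f y
  proof -
    have "{q \<in> T. (f(p := y)) q = Some j} = {q \<in> T. f q = Some j}" for j
      using assms(2) by auto
    then show ?thesis by (simp only: output_counts_def)
  qed
  show ?thesis unfolding counts_law_def pair_map_pmf2
    by (subst Pi_pmf_insert[OF assms])
      (auto simp: pmf.map_comp o_def case_prod_unfold oc intro!: map_pmf_cong)
qed

lemma counts_law_insert:
  assumes "finite T" "p \<notin> T"
  shows "counts_law P (insert p T) = map_pmf (\<lambda>(y, c). c + output_unit y)
    (pair_pmf (particle_output P (fst p)) (counts_law P T))"
  unfolding joint_law_insert[OF assms, symmetric]
  by (simp add: counts_law_def pmf.map_comp o_def)
    (rule map_pmf_cong, simp_all add: output_counts_insert[OF assms])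

text \<open>Particles of equal input type are exchangeable. This is needed because deleting a
  particle from \<open>particles n\<close> need not leave a set of the form
  \<open>particles k\<close>. The induction deletes a particle together with a partner of the same
  type in \<open>S'\<close>.\<close>

lemma counts_law_cong:
  assumes "finite S" "finite S'" "\<And>i. card {p\<in>S. fst p = i} = card {p\<in>S'. fst p = i}"
  shows "counts_law P S = counts_law P S'"
  using assms
proof (induction S arbitrary: S' rule: finite_induct)
  case empty
  have "S' = {}"
  proof (rule ccontr)
    assume "S' \<noteq> {}"
    then obtain p where "p \<in> S'" by blast
    then have "card {q\<in>S'. fst q = fst p} \<noteq> 0" using empty.prems(1) by (cases p) auto
    then show False using empty.prems(2)[of "fst p"] by simp
  qed
  then show ?case by simp
next
  case (insert p T)
  have "p \<in> {q\<in>insert p T. fst q = fst p}" "finite {q\<in>insert p T. fst q = fst p}"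
    using insert.hyps by simp_all
  then have "0 < card {q\<in>S'. fst q = fst p}"
    unfolding insert.prems(2)[symmetric] card_gt_0_iff by blast
  then obtain p' where p': "p' \<in> S'" "fst p' = fst p"
    by (metis (mono_tags, lifting) card_gt_0_iff equals0I mem_Collect_eq)
  define T' where "T' = S' - {p'}"
  have T': "S' = insert p' T'" "p' \<notin> T'" "finite T'" using p' insert.prems by (auto simp: T'_def)
  have "card {q\<in>T. fst q = i} = card {q\<in>T'. fst q = i}" for i
  proof -
    have "{q\<in>insert p T. fst q = i} =
        (if fst p = i then insert p {q\<in>T. fst q = i} else {q\<in>T. fst q = i})"
      "{q\<in>S'. fst q = i} =
        (if fst p = i then insert p' {q\<in>T'. fst q = i} else {q\<in>T'. fst q = i})"
      using T' p'(2) by auto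
    then show ?thesis using insert.prems(2)[of i] insert.hyps T' by (auto split: if_splits)
  qed
  then have "counts_law P T = counts_law P T'" using insert.IH[of T'] T' by blast
  then show ?case
    unfolding T'(1) counts_law_insert[OF insert.hyps] counts_law_insert[OF T'(3,2)] p'(2)
    by simp
qed

text \<open>Both sides are the expected number of particles with output \<open>j\<close> on the event that the
  output is \<open>m + e\<^sub>j\<close>.\<close>

lemma counts_law_size_bias:
  assumes "finite S"
  shows "real (m $ j + 1) * pmf (counts_law P S) (m + axis j 1) =
    (\<Sum>p\<in>S. pmf (particle_output P (fst p)) (Some j) * pmf (counts_law P (S - {p})) m)"
proof -
  define M where "M = Pi_pmf S None (\<lambda>p. particle_output P (fst p))"
  define A where "A = {\<sigma>. output_counts S \<sigma> = m + axis j 1}"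
  have "real (m $ j + 1) * pmf (counts_law P S) (m + axis j 1) =
      (\<integral>\<sigma>. real (m $ j + 1) * indicator A \<sigma> \<partial>measure_pmf M)"
    by (simp add: counts_law_def pmf_map M_def A_def vimage_def)
  also have "\<dots> = (\<integral>\<sigma>. (\<Sum>p\<in>S. indicator {\<sigma>\<in>A. \<sigma> p = Some j} \<sigma>) \<partial>measure_pmf M)"
  proof (intro Bochner_Integration.integral_cong refl)
    fix \<sigma>
    show "real (m $ j + 1) * indicator A \<sigma> = (\<Sum>p\<in>S. indicator {\<sigma>\<in>A. \<sigma> p = Some j} \<sigma>)"
    proof (cases "\<sigma> \<in> A")
      case True
      have "(\<Sum>p\<in>S. indicator {\<sigma>\<in>A. \<sigma> p = Some j} \<sigma>) =
          (\<Sum>p\<in>S. if \<sigma> p = Some j then 1 else (0::real))"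
        using True by (intro sum.cong) auto
      also have "\<dots> = real (card {p\<in>S. \<sigma> p = Some j})"
        using assms by (simp add: sum.If_cases Int_def)
      also have "card {p\<in>S. \<sigma> p = Some j} = output_counts S \<sigma> $ j"
        by (simp add: output_counts_def)
      also have "\<dots> = m $ j + 1" using True by (simp add: A_def)
      finally show ?thesis using True by simp
    qed simp
  qed
  also have "\<dots> = (\<Sum>p\<in>S. measure_pmf.prob M {\<sigma>\<in>A. \<sigma> p = Some j})"
    by (subst Bochner_Integration.integral_sum)
      (auto intro!: measure_pmf.integrable_const_bound[where B=1] simp: indicator_def)
  also have "\<dots> = (\<Sum>p\<in>S. pmf (particle_output P (fst p)) (Some j) * pmf (counts_law P (S - {p})) m)"
  proof (intro sum.cong refl)
    fix p assume p: "p \<in> S"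
    define T where "T = S - {p}"
    have T: "finite T" "p \<notin> T" "S = insert p T" using assms p by (auto simp: T_def)
    \<comment> \<open>If \<open>p\<close> has output \<open>j\<close>, the total is
      \<open>m + axis j 1\<close> exactly when the other particles produce \<open>m\<close>;
      independence then factors the probability.\<close>
    have "{\<sigma>\<in>A. \<sigma> p = Some j} = (\<lambda>\<sigma>. (\<sigma> p, output_counts T \<sigma>)) -` {(Some j, m)}"
      unfolding A_def T(3) by (auto simp: output_counts_insert[OF T(1,2)] output_unit_def)
    then have "measure_pmf.prob M {\<sigma>\<in>A. \<sigma> p = Some j} =
        pmf (map_pmf (\<lambda>\<sigma>. (\<sigma> p, output_counts T \<sigma>)) M) (Some j, m)"
      by (simp add: pmf_map)
    also have "\<dots> = pmf (particle_output P (fst p)) (Some j) * pmf (counts_law P T) m"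
      unfolding M_def T(3) joint_law_insert[OF T(1,2)] by (rule pmf_pair)
    finally show "measure_pmf.prob M {\<sigma>\<in>A. \<sigma> p = Some j} =
      pmf (particle_output P (fst p)) (Some j) * pmf (counts_law P (S - {p})) m"
      by (simp add: T_def)
  qed
  finally show ?thesis .
qed

section \<open>Channel weights and their recursion in the output index\<close>

definition channel_weight :: "real ^ 'm ^ 'd \<Rightarrow> nat ^ 'm \<Rightarrow> nat ^ 'd \<Rightarrow> real" where
  "channel_weight P m n = vec_fact m / vec_fact n * pmf (projection_channel P n) m"

definition column_dir :: "real ^ 'm ^ 'd \<Rightarrow> 'm \<Rightarrow> 'd option \<Rightarrow> real" where
  "column_dir P j i = (case i of None \<Rightarrow> 0 | Some i \<Rightarrow> P $ i $ j)"

lemma vec_fact_pos: "0 < vec_fact n"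
  by (simp add: vec_fact_def prod_pos)

lemma vec_fact_add_axis: "vec_fact (m + axis j 1) = real (m $ j + 1) * vec_fact m"
proof -
  have "vec_fact (m + axis j 1) =
      fact (m $ j + 1) * (\<Prod>i\<in>UNIV - {j}. fact ((m + axis j 1) $ i))"
    unfolding vec_fact_def by (subst prod.remove[of _ j]) simp_all
  also have "(\<Prod>i\<in>UNIV - {j}. fact ((m + axis j 1) $ i)) = (\<Prod>i\<in>UNIV - {j}. fact (m $ i) :: real)"
    by (intro prod.cong) (auto simp: axis_def)
  also have "fact (m $ j + 1) * \<dots> = real (m $ j + 1) * vec_fact m"
    unfolding vec_fact_def by (subst (2) prod.remove[of _ j]) (simp_all add: algebra_simps)
  finally show ?thesis .
qed

lemma channel_weight_nonneg: "0 \<le> channel_weight P m n"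
  using vec_fact_pos[of m] vec_fact_pos[of n] by (simp add: channel_weight_def)

lemma counts_law_particles_remove:
  assumes "p \<in> particles n"
  shows "counts_law P (particles n - {p}) = projection_channel P (n - axis (fst p) 1)"
  unfolding projection_channel_eq
proof (rule counts_law_cong)
  fix i
  have part: "{q \<in> particles k. fst q = i} = {i} \<times> {..<k $ i}" for k :: "nat ^ 'a"
    by (auto simp: particles_def)
  have "{q \<in> particles n - {p}. fst q = i} = {i} \<times> {..<n $ i} - {p}"
    using part by auto
  moreover have "p \<in> {i} \<times> {..<n $ i} \<longleftrightarrow> fst p = i"
    using assms by (auto simp: particles_def)
  ultimately have "card {q \<in> particles n - {p}. fst q = i} = n $ i - (if fst p = i then 1 else 0)"
    by (auto simp: card_cartesian_product_singleton)
  then show "card {q \<in> particles n - {p}. fst q = i} =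
      card {q \<in> particles (n - axis (fst p) 1). fst q = i}"
    unfolding part by (simp add: card_cartesian_product_singleton axis_def)
qed simp_all

text \<open>The size-bias identity in factorial normalization: the \<open>n $ i\<close> particles of
  type \<open>i\<close> contribute equally, and this multiplicity cancels against
  \<open>vec_fact n / vec_fact (n - axis i 1)\<close>. Thus raising the output index by one applies
  the adjoint of the derivative along a column.\<close>

lemma channel_weight_add_axis:
  assumes P: "\<And>i j. 0 \<le> P $ i $ j" "\<And>i. (\<Sum>j\<in>UNIV. P $ i $ j) \<le> 1"
  shows "channel_weight P (m + axis j 1) = dshift_adj (column_dir P j) (channel_weight P m)"
proof
  fix n
  have "real (m $ j + 1) * pmf (projection_channel P n) (m + axis j 1) =
      (\<Sum>p\<in>particles n. P $ fst p $ j * pmf (projection_channel P (n - axis (fst p) 1)) m)"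
    unfolding projection_channel_eq[of P n] counts_law_size_bias[OF finite_particles]
    using P by (intro sum.cong) (simp_all add: counts_law_particles_remove pmf_particle_output)
  also have "\<dots> = (\<Sum>i\<in>UNIV. \<Sum>k<n $ i. P $ i $ j * pmf (projection_channel P (n - axis i 1)) m)"
    unfolding particles_def by (subst sum.Sigma) (auto simp: case_prod_unfold)
  finally have bias: "real (m $ j + 1) * pmf (projection_channel P n) (m + axis j 1) =
      (\<Sum>i\<in>UNIV. real (n $ i) * P $ i $ j * pmf (projection_channel P (n - axis i 1)) m)"
    by (simp add: mult_ac)
  have "channel_weight P (m + axis j 1) n = vec_fact m / vec_fact n *
      (real (m $ j + 1) * pmf (projection_channel P n) (m + axis j 1))"
    unfolding channel_weight_def vec_fact_add_axis by simp
  also have "\<dots> = (\<Sum>i\<in>UNIV. vec_fact m / vec_fact n *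
      (real (n $ i) * P $ i $ j * pmf (projection_channel P (n - axis i 1)) m))"
    unfolding bias sum_distrib_left ..
  also have "\<dots> = (\<Sum>i\<in>UNIV. P $ i $ j *
      (if axis i 1 \<le> n then channel_weight P m (n - axis i 1) else 0))"
  proof (intro sum.cong refl)
    fix i
    show "vec_fact m / vec_fact n *
        (real (n $ i) * P $ i $ j * pmf (projection_channel P (n - axis i 1)) m) =
      P $ i $ j * (if axis i 1 \<le> n then channel_weight P m (n - axis i 1) else 0)"
    proof (cases "0 < n $ i")
      case True
      then have "axis i 1 \<le> n" by (simp only: axis_le_iff)
      then have "vec_fact n = real (n $ i) * vec_fact (n - axis i 1)"
        using vec_fact_add_axis[of "n - axis i 1" i] True by (simp add: vec_diff_add_cancel)
      then show ?thesis
        using True vec_fact_pos[of "n - axis i 1"]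
        by (simp add: channel_weight_def axis_le_iff[of i n, simplified])
    next
      case False
      then show ?thesis using axis_le_iff[of i n] by simp
    qed
  qed
  also have "\<dots> = dshift_adj (column_dir P j) (channel_weight P m) n"
    unfolding dshift_adj_def sum_option_UNIV
    by (simp only: column_dir_def unit_shift_simps option.case mult_zero_left add_0)
  finally show "channel_weight P (m + axis j 1) n = \<dots>" .
qed

definition loss :: "real ^ 'm ^ 'd \<Rightarrow> 'd \<Rightarrow> real" where
  "loss P i = 1 - (\<Sum>j\<in>UNIV. P $ i $ j)"

text \<open>The output is zero exactly when every particle is discarded, and the discards are
  independent.\<close>

lemma channel_weight_zero:
  assumes P: "\<And>i j. 0 \<le> P $ i $ j" "\<And>i. (\<Sum>j\<in>UNIV. P $ i $ j) \<le> 1"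
  shows "channel_weight P 0 n = (\<Prod>i\<in>UNIV. loss P i ^ (n $ i)) / vec_fact n"
proof -
  let ?M = "Pi_pmf (particles n) None (\<lambda>p. particle_output P (fst p))"
  have "pmf (projection_channel P n) 0 = measure_pmf.prob ?M (output_counts (particles n) -` {0})"
    by (simp add: projection_channel_eq counts_law_def pmf_map)
  also have "output_counts (particles n) -` {0} = Pi (particles n) (\<lambda>_. {None :: 'b option})"
  proof -
    have "output_counts (particles n) \<sigma> = 0 \<longleftrightarrow> (\<forall>p\<in>particles n. \<sigma> p = None)"
      for \<sigma> :: "_ \<Rightarrow> 'b option"
    proof -
      have "output_counts (particles n) \<sigma> = 0 \<longleftrightarrow> (\<forall>j. {p \<in> particles n. \<sigma> p = Some j} = {})"
        by (simp add: output_counts_def vec_eq_iff)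
      also have "\<dots> \<longleftrightarrow> (\<forall>p\<in>particles n. \<sigma> p = None)"
        by (auto simp: not_Some_eq[symmetric] simp del: not_Some_eq)
      finally show ?thesis .
    qed
    then show ?thesis by (auto simp: Pi_def)
  qed
  also have "measure_pmf.prob ?M \<dots> = (\<Prod>p\<in>particles n. loss P (fst p))"
    using P by (simp add: measure_Pi_pmf_Pi measure_pmf_single pmf_particle_output loss_def)
  also have "\<dots> = (\<Prod>i\<in>UNIV. \<Prod>k<n $ i. loss P i)"
    unfolding particles_def by (subst prod.Sigma) (auto simp: case_prod_unfold)
  finally show ?thesis by (simp add: channel_weight_def vec_fact_def)
qed

text \<open>The factorials in \<open>channel_weight\<close> turn the kernel of the channel into one
  that acts on factorially weighted masses.\<close>

lemma pairing_channel_weight: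
  "pairing (channel_weight P m) (ulc_weight \<mu>) =
    ennreal (ulc_weight (channel_output_law P \<mu>) m)"
proof -
  have "pairing (channel_weight P m) (ulc_weight \<mu>) = (\<integral>\<^sup>+ n. ennreal (vec_fact m) *
      (ennreal (pmf \<mu> n) * ennreal (pmf (projection_channel P n) m)) \<partial>count_space UNIV)"
    unfolding pairing_def
  proof (intro nn_integral_cong)
    fix n
    have "channel_weight P m n * ulc_weight \<mu> n =
        vec_fact m * (pmf \<mu> n * pmf (projection_channel P n) m)"
      using vec_fact_pos[of n] by (simp add: channel_weight_def ulc_weight_def)
    then show "ennreal (channel_weight P m n * ulc_weight \<mu> n) =
        ennreal (vec_fact m) * (ennreal (pmf \<mu> n) * ennreal (pmf (projection_channel P n) m))"
      using vec_fact_pos[of m] by (simp add: ennreal_mult)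
  qed
  also have "\<dots> = ennreal (vec_fact m) * ennreal (pmf (channel_output_law P \<mu>) m)"
    unfolding channel_output_law_def ennreal_pmf_bind nn_integral_measure_pmf
    by (rule nn_integral_cmult) simp
  finally show ?thesis
    using vec_fact_pos[of m] by (simp add: ulc_weight_def ennreal_mult)
qed

subsection \<open>Thinning as an exponential of a derivative\<close>

text \<open>Coefficients of the exponential of the derivative along \<open>q\<close>: pairing with
  \<open>b\<close> evaluates that operator applied to \<open>b\<close> at \<open>0\<close>.\<close>

definition exp_weight :: "('d \<Rightarrow> real) \<Rightarrow> nat ^ 'd \<Rightarrow> real" where
  "exp_weight q n = (\<Prod>i\<in>UNIV. q i ^ (n $ i)) / vec_fact n"

text \<open>Coefficients of the \<open>l\<close>-th power of the identity plus
  \<open>\<epsilon>\<close> times the derivative along \<open>q\<close>. The factor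
  \<open>(l choose s) * fact s\<close> is a falling factorial, equal to zero for
  \<open>s > l\<close>.\<close>

definition binomial_weight :: "real \<Rightarrow> nat \<Rightarrow> ('d \<Rightarrow> real) \<Rightarrow> nat ^ 'd \<Rightarrow> real" where
  "binomial_weight \<epsilon> l q n = (let s = (\<Sum>i\<in>UNIV. n $ i) in
     \<epsilon> ^ s * (real (l choose s) * fact s) * exp_weight q n)"

definition lazy_dir :: "real \<Rightarrow> ('d \<Rightarrow> real) \<Rightarrow> 'd option \<Rightarrow> real" where
  "lazy_dir \<epsilon> q i = (case i of None \<Rightarrow> 1 | Some i \<Rightarrow> \<epsilon> * q i)"

lemma exp_weight_nonneg: "(\<And>i. 0 \<le> q i) \<Longrightarrow> 0 \<le> exp_weight q n"
  using vec_fact_pos[of n] by (simp add: exp_weight_def prod_nonneg)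

lemma exp_weight_add_axis:
  "real (n $ i + 1) * exp_weight q (n + axis i 1) = q i * exp_weight q n"
proof -
  have "(\<Prod>k\<in>UNIV. q k ^ ((n + axis i 1) $ k)) =
      q i ^ (n $ i + 1) * (\<Prod>k\<in>UNIV - {i}. q k ^ ((n + axis i 1) $ k))"
    by (subst prod.remove[of _ i]) simp_all
  also have "(\<Prod>k\<in>UNIV - {i}. q k ^ ((n + axis i 1) $ k)) = (\<Prod>k\<in>UNIV - {i}. q k ^ (n $ k))"
    by (intro prod.cong) (auto simp: axis_def)
  also have "q i ^ (n $ i + 1) * \<dots> = q i * (\<Prod>k\<in>UNIV. q k ^ (n $ k))"
    by (subst (2) prod.remove[of _ i]) (simp_all add: algebra_simps)
  finally have "(\<Prod>k\<in>UNIV. q k ^ ((n + axis i 1) $ k)) = q i * (\<Prod>k\<in>UNIV. q k ^ (n $ k))" .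
  then show ?thesis
    unfolding exp_weight_def vec_fact_add_axis by (simp del: vector_add_component One_nat_def)
qed

lemma sum_add_axis: "(\<Sum>k\<in>UNIV. (n + axis i 1) $ k) = Suc (\<Sum>k\<in>UNIV. n $ k)"
  for n :: "nat ^ 'd"
  by (simp add: sum.distrib axis_def)

lemma binomial_weight_Suc:
  "dshift_adj (lazy_dir \<epsilon> q) (binomial_weight \<epsilon> l q) = binomial_weight \<epsilon> (Suc l) q"
proof
  fix n :: "nat ^ 'a"
  define s where "s = (\<Sum>i\<in>UNIV. n $ i)"
  \<comment> \<open>Each type \<open>i\<close> contributes \<open>n $ i\<close> times the common
    factor \<open>c\<close>, in total \<open>s * c\<close>, and Pascal's rule finishes. The
    truncated \<open>s - 1\<close> is harmless at \<open>s = 0\<close>, where the multiplier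
    vanishes.\<close>
  define c where "c = \<epsilon> ^ s * (real (l choose (s - 1)) * fact (s - 1)) * exp_weight q n"
  have "lazy_dir \<epsilon> q (Some i) *
      (if axis i 1 \<le> n then binomial_weight \<epsilon> l q (n - axis i 1) else 0) = real (n $ i) * c" for i
  proof (cases "0 < n $ i")
    case True
    then have le: "axis i 1 \<le> n" by (simp only: axis_le_iff)
    define k where "k = n - axis i 1"
    have n: "n = k + axis i 1" by (simp only: k_def vec_diff_add_cancel[OF le])
    have s: "s = Suc (\<Sum>i\<in>UNIV. k $ i)" by (simp only: s_def n sum_add_axis)
    have "real (n $ i) * c = \<epsilon> * (\<epsilon> ^ (s - 1) * (real (l choose (s - 1)) * fact (s - 1))) *
        (real (k $ i + 1) * exp_weight q (k + axis i 1))"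
      unfolding c_def n s by (simp add: mult_ac)
    also have "\<dots> = \<epsilon> * q i * binomial_weight \<epsilon> l q k"
      unfolding exp_weight_add_axis by (simp add: binomial_weight_def Let_def s)
    finally show ?thesis unfolding k_def using le by (simp add: lazy_dir_def)
  next
    case False
    then show ?thesis using axis_le_iff[of i n] by simp
  qed
  then have "dshift_adj (lazy_dir \<epsilon> q) (binomial_weight \<epsilon> l q) n =
      binomial_weight \<epsilon> l q n + (\<Sum>i\<in>UNIV. real (n $ i) * c)"
    unfolding dshift_adj_def sum_option_UNIV unit_shift_simps
    by (simp add: lazy_dir_def less_eq_vec_def)
  also have "(\<Sum>i\<in>UNIV. real (n $ i) * c) = real s * c"
    by (simp add: s_def sum_distrib_right)
  also have "binomial_weight \<epsilon> l q n + \<dots> = binomial_weight \<epsilon> (Suc l) q n"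
    unfolding binomial_weight_def c_def s_def[symmetric] Let_def
    by (cases s) (simp_all add: algebra_simps)
  finally show "dshift_adj (lazy_dir \<epsilon> q) (binomial_weight \<epsilon> l q) n = \<dots>" .
qed

lemma binomial_weight_0: "binomial_weight \<epsilon> 0 q n = indicator {0} n"
proof (cases "n = 0")
  case True
  then show ?thesis by (simp add: binomial_weight_def exp_weight_def vec_fact_def)
next
  case False
  then obtain i where "n $ i \<noteq> 0" by (auto simp: vec_eq_iff)
  then have "(\<Sum>i\<in>UNIV. n $ i) \<noteq> 0" by auto
  then have "0 choose (\<Sum>i\<in>UNIV. n $ i) = (0 :: nat)"
    by (intro binomial_eq_0 neq0_conv[THEN iffD1])
  then show ?thesis using False by (simp add: binomial_weight_def Let_def)
qed

lemma binomial_weight_nonneg: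
  "0 \<le> \<epsilon> \<Longrightarrow> (\<And>i. 0 \<le> q i) \<Longrightarrow> 0 \<le> binomial_weight \<epsilon> l q n"
  using exp_weight_nonneg[of q n] by (simp add: binomial_weight_def Let_def)

lemma lazy_dir_nonneg: "0 \<le> \<epsilon> \<Longrightarrow> (\<And>i. 0 \<le> q i) \<Longrightarrow> 0 \<le> lazy_dir \<epsilon> q i"
  by (simp add: lazy_dir_def split: option.split)

text \<open>Duality moves one factor at a time from the weight to \<open>b\<close>; with no factor
  left, the weight is evaluation at \<open>0\<close>.\<close>

lemma pairing_binomial_weight:
  assumes "0 \<le> \<epsilon>" "\<And>i. 0 \<le> q i" "\<And>n. 0 \<le> b n"
  shows "pairing (binomial_weight \<epsilon> l q) b = ennreal ((dshift (lazy_dir \<epsilon> q) ^^ l) b 0)"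
  using assms(3)
proof (induction l arbitrary: b)
  case 0
  have "pairing (binomial_weight \<epsilon> 0 q) b =
      (\<integral>\<^sup>+ n. ennreal (b n * indicator {0} n) \<partial>count_space UNIV)"
    unfolding pairing_def binomial_weight_0 by (simp add: mult.commute)
  then show ?case by (simp add: nn_integral_indicator_singleton')
next
  case (Suc l)
  have "pairing (binomial_weight \<epsilon> (Suc l) q) b =
      pairing (binomial_weight \<epsilon> l q) (dshift (lazy_dir \<epsilon> q) b)"
    unfolding binomial_weight_Suc[symmetric]
    by (rule pairing_dshift[symmetric])
      (use assms(1,2) Suc.prems in \<open>auto intro: lazy_dir_nonneg binomial_weight_nonneg\<close>)
  also have "\<dots> = ennreal ((dshift (lazy_dir \<epsilon> q) ^^ l) (dshift (lazy_dir \<epsilon> q) b) 0)"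
    by (rule Suc.IH) (intro dshift_nonneg lazy_dir_nonneg assms(1,2) Suc.prems)
  finally show ?case by (simp add: funpow_swap1)
qed

text \<open>This bound lets \<open>exp_weight\<close> dominate the binomial weights in the limit.
  The case \<open>l = 0\<close> relies on \<open>1 / 0 = 0\<close>.\<close>

lemma falling_factorial_ratio_le: "(1 / real l) ^ s * (real (l choose s) * fact s) \<le> 1"
proof (cases "l = 0")
  case True
  then show ?thesis by (cases s) simp_all
next
  case False
  have "real ((l choose s) * fact s) \<le> real (l ^ s)"
    by (rule of_nat_mono) (rule binomial_fact_pow)
  then show ?thesis using False by (simp add: power_divide)
qed

lemma falling_factorial_ratio_tendsto:
  "(\<lambda>l. (1 / real l) ^ s * (real (l choose s) * fact s)) \<longlonglongrightarrow> 1"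
proof (induction s)
  case 0
  show ?case by simp
next
  case (Suc s)
  have "(\<lambda>l. (1 / real l) ^ s * (real (l choose s) * fact s) * (1 - real s * (1 / real l))) \<longlonglongrightarrow>
      1 * (1 - real s * 0)"
    by (intro tendsto_intros Suc.IH lim_1_over_n)
  moreover have "\<forall>\<^sub>F l in sequentially.
      (1 / real l) ^ s * (real (l choose s) * fact s) * (1 - real s * (1 / real l)) =
      (1 / real l) ^ Suc s * (real (l choose Suc s) * fact (Suc s))"
    \<comment> \<open>For \<open>l > s\<close> the natural subtraction \<open>l - s\<close> is not
      truncated and \<open>l\<close> is nonzero.\<close>
    using eventually_gt_at_top[of s]
  proof eventually_elim
    case (elim l)
    have "Suc s * (l choose Suc s) = (l - s) * (l choose s)"
      by (simp only: binomial_absorb_comp binomial_absorption)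
    then have "real (Suc s * (l choose Suc s)) = real ((l - s) * (l choose s))"
      by (rule arg_cong)
    then have *: "real (Suc s) * real (l choose Suc s) = (real l - real s) * real (l choose s)"
      using elim by (simp only: of_nat_mult of_nat_diff less_imp_le)
    have "(1 / real l) ^ Suc s * (real (l choose Suc s) * fact (Suc s)) =
        (1 / real l) ^ Suc s * fact s * (real (Suc s) * real (l choose Suc s))"
      by (simp add: algebra_simps)
    also have "\<dots> = (1 / real l) ^ s * (real (l choose s) * fact s) * (1 - real s * (1 / real l))"
      unfolding * using elim by (simp add: field_simps)
    finally show ?case by simp
  qed
  ultimately show ?case by (auto dest: Lim_transform_eventually)
qed

text \<open>This is \<open>(1 + D/l)\<^sup>l \<longrightarrow> exp D\<close> for the operator \<open>D = \<Sum>\<^sub>i q\<^sub>i \<partial>\<^sub>i\<close>.\<close>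

lemma lazy_dir_powers_tendsto:
  assumes q: "\<And>i. 0 \<le> q i" and b: "\<And>n. 0 \<le> b n" and L: "0 \<le> L"
    and pair: "pairing (exp_weight q) b = ennreal L"
  shows "(\<lambda>l. (dshift (lazy_dir (1 / real l) q) ^^ l) b 0) \<longlonglongrightarrow> L"
proof -
  let ?w = "\<lambda>l. binomial_weight (1 / real l) l q"
  have "(\<lambda>l. pairing (?w l) b) \<longlonglongrightarrow> pairing (exp_weight q) b"
    unfolding pairing_def
  \<comment> \<open>The majorant \<open>exp_weight q n * b n\<close> has finite integral because the
    pairing is the real number \<open>L\<close>.\<close>
  proof (rule nn_integral_dominated_convergence)
    show "(\<integral>\<^sup>+ n. ennreal (exp_weight q n * b n) \<partial>count_space UNIV) < \<infinity>"
      using pair by (simp add: pairing_def)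
    show "AE n in count_space UNIV. ennreal (?w l n * b n) \<le> ennreal (exp_weight q n * b n)" for l
    proof (intro AE_I2 ennreal_leI mult_right_mono b)
      fix n
      show "?w l n \<le> exp_weight q n"
        unfolding binomial_weight_def Let_def
        using mult_right_mono[OF falling_factorial_ratio_le exp_weight_nonneg[OF q, where n = n]]
        by simp
    qed
    show "AE n in count_space UNIV.
        (\<lambda>l. ennreal (?w l n * b n)) \<longlonglongrightarrow> ennreal (exp_weight q n * b n)"
    proof (intro AE_I2 tendsto_ennrealI tendsto_mult_right)
      fix n
      have "(\<lambda>l. ?w l n) \<longlonglongrightarrow> 1 * exp_weight q n"
        unfolding binomial_weight_def Let_def
        by (intro tendsto_intros falling_factorial_ratio_tendsto)
      then show "(\<lambda>l. ?w l n) \<longlonglongrightarrow> exp_weight q n" by simp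
    qed
  qed simp_all
  moreover have "pairing (?w l) b = ennreal ((dshift (lazy_dir (1 / real l) q) ^^ l) b 0)" for l
    by (rule pairing_binomial_weight) (simp_all add: q b)
  \<comment> \<open>Nonnegativity is what transfers the limit from \<open>ennreal\<close> back to
    the reals.\<close>
  moreover have "0 \<le> (dshift (lazy_dir (1 / real l) q) ^^ k) b n" for l k n
    by (induction k arbitrary: n) (auto intro!: b dshift_nonneg lazy_dir_nonneg q)
  ultimately show ?thesis using L by (simp add: pair tendsto_ennreal_iff)
qed

section \<open>The second-order inequality for the output weights\<close>

lemma dshift_funpow_commute: "(dshift p ^^ l) (dshift q a) = dshift q ((dshift p ^^ l) a)"
  by (induction l) (simp_all add: dshift_commute[of p q])

lemma ulc_seq_dshift_funpow:
  "ulc_seq a \<Longrightarrow> (\<And>i. 0 \<le> p i) \<Longrightarrow> ulc_seq ((dshift p ^^ l) a)"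
  by (induction l) (auto intro: ulc_seq_dshift)

lemma dshift_sum_dir:
  "dshift (\<lambda>i. \<Sum>j\<in>J. u j * p j i) a n = (\<Sum>j\<in>J. u j * dshift (p j) a n)"
  unfolding dshift_def sum_distrib_right sum_distrib_left
  by (subst sum.swap) (simp add: mult_ac)

lemma dshift_sum_dir2:
  "dshift (\<lambda>i. \<Sum>j\<in>J. u j * p j i) (dshift (\<lambda>i. \<Sum>j\<in>J. u j * p j i) a) n =
    (\<Sum>j\<in>J. \<Sum>l\<in>J. u j * u l * dshift (p j) (dshift (p l) a) n)"
proof -
  have eq: "dshift (\<lambda>i. \<Sum>j\<in>J. u j * p j i) a = (\<lambda>n. \<Sum>j\<in>J. u j * dshift (p j) a n)"
    by (rule ext) (rule dshift_sum_dir)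
  have "dshift r (\<lambda>n. \<Sum>j\<in>J. u j * dshift (p j) a n) n =
      (\<Sum>l\<in>J. u l * dshift r (dshift (p l) a) n)" for r
    unfolding dshift_def[of r] sum_distrib_left by (subst sum.swap) (simp add: mult_ac)
  then show ?thesis
    unfolding dshift_sum_dir eq by (simp add: sum_distrib_left mult_ac)
qed

lemma column_dir_nonneg: "(\<And>i j. 0 \<le> P $ i $ j) \<Longrightarrow> 0 \<le> column_dir P j i"
  by (simp add: column_dir_def split: option.split)

lemma channel_weight_zero_eq:
  assumes "\<And>i j. 0 \<le> P $ i $ j" "\<And>i. (\<Sum>j\<in>UNIV. P $ i $ j) \<le> 1"
  shows "channel_weight P 0 = exp_weight (loss P)"
  by (rule ext) (simp add: channel_weight_zero[OF assms] exp_weight_def)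

lemma pairing_channel_weight_add_axis:
  assumes P: "\<And>i j. 0 \<le> P $ i $ j" "\<And>i. (\<Sum>j\<in>UNIV. P $ i $ j) \<le> 1"
    and b: "\<And>n. 0 \<le> b n"
  shows "pairing (channel_weight P (m + axis j 1)) b =
    pairing (channel_weight P m) (dshift (column_dir P j) b)"
  unfolding channel_weight_add_axis[OF P]
  by (rule pairing_dshift[symmetric]) (auto intro: column_dir_nonneg P channel_weight_nonneg b)

lemma vec_nat_induct [case_names zero add_axis]:
  fixes m :: "nat ^ 'm"
  assumes "Q 0" "\<And>m j. Q m \<Longrightarrow> Q (m + axis j 1)"
  shows "Q m"
proof (induction "\<Sum>i\<in>UNIV. m $ i" arbitrary: m)
  case 0
  then have "m = 0" by (simp add: vec_eq_iff)
  then show ?case using assms(1) by simp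
next
  case (Suc s)
  then obtain j where "0 < m $ j" by (metis gr0I sum.neutral Zero_not_Suc)
  then have "axis j 1 \<le> m" by (simp only: axis_le_iff)
  then have m: "m = (m - axis j 1) + axis j 1" by (simp only: vec_diff_add_cancel)
  have "Suc s = Suc (\<Sum>i\<in>UNIV. (m - axis j 1) $ i)"
    using Suc.hyps(2) sum_add_axis[of "m - axis j 1" j] unfolding m[symmetric] by simp
  then show ?case using assms(2)[OF Suc.hyps(1)[of "m - axis j 1"], of j] m by simp
qed

text \<open>Induction on \<open>m\<close> with \<open>a\<close> arbitrary: a unit of output
  \<open>j\<close> is absorbed into \<open>a\<close> as the derivative along column
  \<open>j\<close>, which preserves ULC. At \<open>m = 0\<close> the weight is an exponential, and
  the inequality is the limit of those for the powers of \<open>lazy_dir\<close>.\<close>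

lemma pairing_channel_weight_ulc:
  assumes P: "\<And>i j. 0 \<le> P $ i $ j" "\<And>i. (\<Sum>j\<in>UNIV. P $ i $ j) \<le> 1"
    and a: "ulc_seq a"
    and A: "pairing (channel_weight P m) a = ennreal A" "0 \<le> A"
    and B: "\<And>j. pairing (channel_weight P m) (dshift (column_dir P j) a) = ennreal (B j)"
      "\<And>j. 0 \<le> B j"
    and C: "\<And>j l. pairing (channel_weight P m)
        (dshift (column_dir P j) (dshift (column_dir P l) a)) = ennreal (C j l)" "\<And>j l. 0 \<le> C j l"
  shows "A * (\<Sum>j\<in>UNIV. \<Sum>l\<in>UNIV. u j * u l * C j l) \<le> (\<Sum>j\<in>UNIV. u j * B j)\<^sup>2"
  using a A(1) B(1) C(1)
proof (induction m arbitrary: a rule: vec_nat_induct)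
  case zero
  have q: "0 \<le> loss P i" for i using P(2)[of i] by (simp add: loss_def)
  define a' where "a' l = (dshift (lazy_dir (1 / real l) (loss P)) ^^ l) a" for l
  define D where "D j = dshift (column_dir P j)" for j
  note w = zero[unfolded channel_weight_zero_eq[OF P]]
  note a0 = ulc_seqD(1)[OF zero(1)]
  note col = column_dir_nonneg[of P, OF P(1)]
  note lim = lazy_dir_powers_tendsto[where q = "loss P", OF q]
  have "(\<lambda>l. a' l 0) \<longlonglongrightarrow> A"
    unfolding a'_def by (rule lim[OF a0 A(2) w(2)])
  \<comment> \<open>The column derivatives commute with the powers, so the limit applies with
    \<open>a\<close> replaced by its column derivatives.\<close>
  moreover have B': "(\<lambda>l. D j (a' l) 0) \<longlonglongrightarrow> B j" for j
    unfolding a'_def D_def dshift_funpow_commute[symmetric]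
    by (rule lim[OF _ B(2) w(3)]) (intro dshift_nonneg col a0)
  moreover have C': "(\<lambda>l. D j (D k (a' l)) 0) \<longlonglongrightarrow> C j k" for j k
    unfolding a'_def D_def dshift_funpow_commute[symmetric]
    by (rule lim[OF _ C(2) w(4)]) (intro dshift_nonneg col a0)
  ultimately have lims:
    "(\<lambda>l. a' l 0 * (\<Sum>j\<in>UNIV. \<Sum>k\<in>UNIV. u j * u k * D j (D k (a' l)) 0)) \<longlonglongrightarrow>
      A * (\<Sum>j\<in>UNIV. \<Sum>k\<in>UNIV. u j * u k * C j k)"
    "(\<lambda>l. (\<Sum>j\<in>UNIV. u j * D j (a' l) 0)\<^sup>2) \<longlonglongrightarrow> (\<Sum>j\<in>UNIV. u j * B j)\<^sup>2"
    by (intro tendsto_intros; simp)+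
  have "a' l 0 * (\<Sum>j\<in>UNIV. \<Sum>k\<in>UNIV. u j * u k * D j (D k (a' l)) 0)
      \<le> (\<Sum>j\<in>UNIV. u j * D j (a' l) 0)\<^sup>2" for l
  proof -
    have "ulc_seq (a' l)"
      unfolding a'_def by (intro ulc_seq_dshift_funpow zero lazy_dir_nonneg q) simp
    \<comment> \<open>The ULC inequality at \<open>0\<close> is applied to a combination of columns;
      \<open>u\<close> may have either sign, since the direction in that inequality is
      unrestricted.\<close>
    from ulc_seqD(3)[OF this, of 0 "\<lambda>i. \<Sum>j\<in>UNIV. u j * column_dir P j i"] show ?thesis
      unfolding dshift_sum_dir2 unfolding dshift_sum_dir D_def .
  qed
  then show ?case by (intro LIMSEQ_le[OF lims]) blast
next
  case (add_axis m j)
  note a0 = ulc_seqD(1)[OF add_axis.prems(1)]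
  note col = column_dir_nonneg[of P, OF P(1)]
  let ?D = "\<lambda>j. dshift (column_dir P j)"
  have step: "pairing (channel_weight P (m + axis j 1)) b = pairing (channel_weight P m) (?D j b)"
    if "\<And>n. 0 \<le> b n" for b
    by (rule pairing_channel_weight_add_axis[OF P that])
  show ?case
  proof (rule add_axis.IH)
    show "ulc_seq (?D j a)" by (intro ulc_seq_dshift add_axis.prems(1) col)
    show "pairing (channel_weight P m) (?D j a) = ennreal A"
      using add_axis.prems(2) step[of a] a0 by simp
    show "pairing (channel_weight P m) (?D k (?D j a)) = ennreal (B k)" for k
      using add_axis.prems(3)[of k] step[of "?D k a"] dshift_nonneg[of "column_dir P k" a] col a0
      by (simp add: dshift_commute[of "column_dir P k"])
    show "pairing (channel_weight P m) (?D k (?D l (?D j a))) = ennreal (C k l)" for k l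
      using add_axis.prems(4)[of k l] step[of "?D k (?D l a)"]
        dshift_nonneg[of "column_dir P k" "?D l a"] dshift_nonneg[of "column_dir P l" a] col a0
      by (simp add: dshift_commute[of _ "column_dir P j"])
  qed
qed

subsection \<open>ULC laws\<close>

lemma ulc_weight_nonneg: "0 \<le> ulc_weight \<mu> n"
  using vec_fact_pos[of n] by (simp add: ulc_weight_def)

lemma ulc_weight_eq_0_iff: "ulc_weight \<mu> n = 0 \<longleftrightarrow> n \<notin> set_pmf \<mu>"
  using vec_fact_pos[of n] by (simp add: ulc_weight_def set_pmf_iff)

text \<open>Descent by single units suffices, by induction on the difference
  \<open>n - m\<close>.\<close>

lemma downward_closed_iff:
  "downward_closed S \<longleftrightarrow> (\<forall>n i. n + axis i 1 \<in> S \<longrightarrow> n \<in> S)"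
proof
  assume "downward_closed S"
  moreover have "n \<le> n + axis i 1" for n :: "nat ^ 'a" and i
    by (simp add: less_eq_vec_def)
  ultimately show "\<forall>n i. n + axis i 1 \<in> S \<longrightarrow> n \<in> S"
    unfolding downward_closed_def by blast
next
  assume step: "\<forall>n i. n + axis i 1 \<in> S \<longrightarrow> n \<in> S"
  have add: "m + k \<in> S \<Longrightarrow> m \<in> S" for m k
  proof (induction k rule: vec_nat_induct)
    case (add_axis k i)
    then show ?case using step unfolding add.assoc[symmetric] by blast
  qed simp
  show "downward_closed S" unfolding downward_closed_def
  proof (intro ballI allI impI)
    fix n m :: "nat ^ 'a" assume "n \<in> S" "m \<le> n"
    then show "m \<in> S" using add[of m "n - m"] vec_diff_add_cancel[of m n] by (simp add: add.commute)
  qed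
qed

text \<open>Testing positive semidefiniteness on
  \<open>v (Some i) * ulc_weight \<mu> (n + axis i 1)\<close> clears the denominators.\<close>

lemma ulc_seq_ulc_weight:
  assumes "ulc \<mu>"
  shows "ulc_seq (ulc_weight \<mu>)"
proof -
  let ?a = "ulc_weight \<mu>"
  have zero: "?a (n + axis i 1) = 0" if "?a n = 0" for n i
    using assms that unfolding ulc_def downward_closed_iff ulc_weight_eq_0_iff by blast
  have "?a n * dshift v (dshift v ?a) n \<le> (dshift v ?a n)\<^sup>2" for n v
  proof (cases "?a n = 0")
    case True
    then show ?thesis by simp
  next
    case False
    define I where "I = up_neighbours \<mu> n"
    define X where "X = (\<Sum>i\<in>UNIV. v (Some i) * ?a (n + axis i 1))"
    define Y where "Y = (\<Sum>i\<in>UNIV. \<Sum>j\<in>UNIV.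
      v (Some i) * v (Some j) * ?a (n + axis i 1 + axis j 1))"
    \<comment> \<open>Downward closure makes all terms through an index outside \<open>I\<close>
      vanish, so full sums may be restricted to \<open>I\<close>.\<close>
    have out: "?a (n + axis i 1) = 0" "?a (n + axis i 1 + axis j 1) = 0"
      "?a (n + axis j 1 + axis i 1) = 0" if "i \<notin> I" for i j
    proof -
      show 1: "?a (n + axis i 1) = 0"
        using that unfolding ulc_weight_eq_0_iff I_def up_neighbours_def by blast
      then show 2: "?a (n + axis i 1 + axis j 1) = 0" by (rule zero)
      then show "?a (n + axis j 1 + axis i 1) = 0" by (simp only: add_ac)
    qed
    have X: "X = (\<Sum>i\<in>I. v (Some i) * ?a (n + axis i 1))"
      unfolding X_def by (rule sum.mono_neutral_right) (auto simp: out simp del: One_nat_def)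
    have "Y = (\<Sum>i\<in>I. \<Sum>j\<in>UNIV. v (Some i) * v (Some j) * ?a (n + axis i 1 + axis j 1))"
      unfolding Y_def by (rule sum.mono_neutral_right) (auto simp: out simp del: One_nat_def)
    also have "\<dots> = (\<Sum>i\<in>I. \<Sum>j\<in>I. v (Some i) * v (Some j) * ?a (n + axis i 1 + axis j 1))"
      by (intro sum.cong refl sum.mono_neutral_right) (auto simp: out simp del: One_nat_def)
    finally have Y: "Y = \<dots>" .
    let ?w = "\<lambda>i. v (Some i) * ?a (n + axis i 1)"
    have "psd_on I (\<lambda>i j. 1 - ?a n * ?a (n + axis i 1 + axis j 1)
        / (?a (n + axis i 1) * ?a (n + axis j 1)))"
      using assms False unfolding ulc_def ulc_weight_eq_0_iff I_def by blast
    then have "0 \<le> (\<Sum>i\<in>I. \<Sum>j\<in>I. ?w i * (1 - ?a n * ?a (n + axis i 1 + axis j 1)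
        / (?a (n + axis i 1) * ?a (n + axis j 1))) * ?w j)"
      unfolding psd_on_def by (elim conjE allE[where x = ?w])
    also have "\<dots> = (\<Sum>i\<in>I. \<Sum>j\<in>I. ?w i * ?w j -
        ?a n * (v (Some i) * v (Some j) * ?a (n + axis i 1 + axis j 1)))"
    proof (intro sum.cong refl)
      fix i j assume "i \<in> I" "j \<in> I"
      then have "?a (n + axis i 1) \<noteq> 0" "?a (n + axis j 1) \<noteq> 0"
        unfolding ulc_weight_eq_0_iff I_def up_neighbours_def by blast+
      then show "?w i * (1 - ?a n * ?a (n + axis i 1 + axis j 1)
          / (?a (n + axis i 1) * ?a (n + axis j 1))) * ?w j =
        ?w i * ?w j - ?a n * (v (Some i) * v (Some j) * ?a (n + axis i 1 + axis j 1))"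
        by (simp add: field_simps)
    qed
    also have "\<dots> = X\<^sup>2 - ?a n * Y"
      unfolding X Y power2_eq_square sum_product
      by (simp add: sum_subtractf sum_distrib_left)
    finally have "?a n * Y \<le> X\<^sup>2" by simp
    moreover have "dshift v ?a n = v None * ?a n + X"
      by (simp only: dshift_option X_def)
    moreover have "dshift v (dshift v ?a) n = v None * (v None * ?a n + X) + (v None * X + Y)"
      unfolding dshift_option X_def Y_def
      by (simp add: distrib_left sum.distrib sum_distrib_left mult_ac)
    ultimately show ?thesis by (simp add: power2_eq_square algebra_simps)
  qed
  then show ?thesis unfolding ulc_seq_def using zero ulc_weight_nonneg by blast
qed

theorem theoremE14:
  fixes \<mu> :: "(nat ^ 'd) pmf" and P :: "real ^ 'm ^ 'd"
  assumes "ulc \<mu>"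
    and "\<And>i j. 0 \<le> P $ i $ j"
    and "\<And>i. (\<Sum>j\<in>UNIV. P $ i $ j) \<le> 1"
  shows "ulc (channel_output_law P \<mu>)"
proof -
  let ?a = "ulc_weight \<mu>"
  let ?b = "ulc_weight (channel_output_law P \<mu>)"
  let ?D = "\<lambda>j. dshift (column_dir P j)"
  note P = assms(2,3)
  note a = ulc_seq_ulc_weight[OF assms(1)]
  note b0 = ulc_weight_nonneg[of "channel_output_law P \<mu>"]
  have D0: "0 \<le> ?D j ?a n" for j n
    by (intro dshift_nonneg column_dir_nonneg P(1) ulc_weight_nonneg)
  have A: "pairing (channel_weight P m) ?a = ennreal (?b m)" for m
    by (rule pairing_channel_weight)
  have B: "pairing (channel_weight P m) (?D j ?a) = ennreal (?b (m + axis j 1))" for m j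
    using pairing_channel_weight_add_axis[OF P, of ?a m j] A[of "m + axis j 1"] ulc_weight_nonneg
    by metis
  have C: "pairing (channel_weight P m) (?D j (?D l ?a)) =
      ennreal (?b (m + axis j 1 + axis l 1))" for m j l
    using pairing_channel_weight_add_axis[OF P, of "?D l ?a" m j] B[of "m + axis j 1" l] D0
    by metis
  \<comment> \<open>A vanishing pairing forces \<open>channel_weight P m\<close> to vanish wherever
    \<open>?a\<close> does not; where \<open>?a\<close> vanishes, so does its column derivative.
    Hence the pairing with the derivative is zero too.\<close>
  have zero: "?b (m + axis j 1) = 0" if "?b m = 0" for m j
  proof -
    have "pairing (channel_weight P m) ?a = 0" using A[of m] that by simp
    then have *: "channel_weight P m n * ?a n \<le> 0" for n
      by (simp add: pairing_def nn_integral_0_iff_AE AE_count_space ennreal_eq_0_iff)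
    have "channel_weight P m n * ?D j ?a n = 0" for n
    proof (cases "?a n = 0")
      case True
      then show ?thesis using ulc_seq_zero_dshift[OF a] by simp
    next
      case False
      then have "channel_weight P m n = 0"
        using *[of n] ulc_weight_nonneg[of \<mu> n] channel_weight_nonneg[of P m n]
        by (auto simp: mult_le_0_iff)
      then show ?thesis by simp
    qed
    then have "pairing (channel_weight P m) (?D j ?a) = 0"
      unfolding pairing_def by (simp only: ennreal_0 nn_integral_0_iff_AE) simp
    then show ?thesis using B[of m j] b0 by (simp add: ennreal_eq_0_iff antisym)
  qed
  have "psd_on (up_neighbours (channel_output_law P \<mu>) m)
      (\<lambda>i j. 1 - ?b m * ?b (m + axis i 1 + axis j 1) / (?b (m + axis i 1) * ?b (m + axis j 1)))" for m
  proof -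
    define I where "I = up_neighbours (channel_output_law P \<mu>) m"
    have nz: "?b (m + axis i 1) \<noteq> 0" if "i \<in> I" for i
      using that unfolding I_def up_neighbours_def ulc_weight_eq_0_iff by blast
    have "0 \<le> (\<Sum>i\<in>I. \<Sum>j\<in>I. v i * (1 - ?b m * ?b (m + axis i 1 + axis j 1)
        / (?b (m + axis i 1) * ?b (m + axis j 1))) * v j)" for v
    proof -
      \<comment> \<open>Dividing by the weights restores the denominators, and extension by zero
        passes from \<open>I\<close> to all indices.\<close>
      define u where "u i = (if i \<in> I then v i / ?b (m + axis i 1) else 0)" for i
      have "?b m * (\<Sum>i\<in>UNIV. \<Sum>j\<in>UNIV. u i * u j * ?b (m + axis i 1 + axis j 1))
          \<le> (\<Sum>i\<in>UNIV. u i * ?b (m + axis i 1))\<^sup>2"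
        by (rule pairing_channel_weight_ulc[OF P a A b0 B b0 C b0])
      also have "(\<Sum>i\<in>UNIV. u i * ?b (m + axis i 1)) = (\<Sum>i\<in>I. u i * ?b (m + axis i 1))"
        by (rule sum.mono_neutral_right) (auto simp: u_def)
      also have "\<dots> = (\<Sum>i\<in>I. v i)"
        by (intro sum.cong refl) (use nz in \<open>simp add: u_def\<close>)
      also have "(\<Sum>i\<in>I. v i)\<^sup>2 = (\<Sum>i\<in>I. \<Sum>j\<in>I. v i * v j)"
        unfolding power2_eq_square by (rule sum_product)
      also have "(\<Sum>i\<in>UNIV. \<Sum>j\<in>UNIV. u i * u j * ?b (m + axis i 1 + axis j 1)) =
          (\<Sum>i\<in>I. \<Sum>j\<in>UNIV. u i * u j * ?b (m + axis i 1 + axis j 1))"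
        by (rule sum.mono_neutral_right) (auto simp: u_def)
      also have "\<dots> = (\<Sum>i\<in>I. \<Sum>j\<in>I. u i * u j * ?b (m + axis i 1 + axis j 1))"
        by (intro sum.cong refl sum.mono_neutral_right) (auto simp: u_def)
      finally have "0 \<le> (\<Sum>i\<in>I. \<Sum>j\<in>I. v i * v j - ?b m * (u i * u j * ?b (m + axis i 1 + axis j 1)))"
        by (simp only: sum_subtractf sum_distrib_left diff_ge_0_iff_ge)
      also have "\<dots> = (\<Sum>i\<in>I. \<Sum>j\<in>I. v i * (1 - ?b m * ?b (m + axis i 1 + axis j 1)
          / (?b (m + axis i 1) * ?b (m + axis j 1))) * v j)"
        by (intro sum.cong refl) (simp add: u_def algebra_simps)
      finally show ?thesis .
    qed
    then show ?thesis unfolding psd_on_def I_def[symmetric] by (simp add: mult_ac add_ac)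
  qed
  moreover have "downward_closed (set_pmf (channel_output_law P \<mu>))"
    unfolding downward_closed_iff using zero unfolding ulc_weight_eq_0_iff by blast
  ultimately show ?thesis unfolding ulc_def by blast
qed

end
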